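(* The algorithm GenerateCandidateFSCs (described in the context) is sound: every pair of structures $(\mathcal{I}_d,\mathcal{I}_a)$ in its output is a correct output, i.e. the global Markov chain of $\mathcal{SG}^\phi$ under finite state controllers with structures $(\mathcal{I}_d,\mathcal{I}_a)$ has a $\phi$-feasible recurrent set.
   Context: **POSG.** A partially observable stochastic game is $\mathcal{SG}=(S,s_0,U_d,U_a,\mathbb{T},\mathcal{O}_d,\mathcal{O}_a,O_d,O_a,\mathcal{AP},\mathcal{L})$: $S$ is a finite state set with initial state $s_0$; $U_d,U_a$ are finite action sets of defender and adversary; $\mathbb{T}(s'|s,u_d,u_a)$ are transition probabilities; $\mathcal{O}_d,\mathcal{O}_a$ are finite observation sets; $O_*(o|s)$, $*\in\{d,a\}$, is the probability of observing $o\in\mathcal{O}_*$ in state $s$; $\mathcal{L}:S\to 2^{\mathcal{AP}}$ is a labeling. **Product-POSG.** The LTL formula $\phi$ is represented by a deterministic Rabin automaton $(Q,2^{\mathcal{AP}},\delta,q_0,\{(L(i),K(i))\}_{i=1}^M)$ (a run is accepting if for some $i$ it visits $L(i)$ finitely often and $K(i)$ infinitely often). $\mathcal{SG}^\phi$ has states $S^\phi=S\times Q$, initial state $(s_0,q_0)$, transitions $\mathbb{T}^\phi((s',q')|(s,q),u_d,u_a)=\mathbb{T}(s'|s,u_d,u_a)$ if $\delta(q,\mathcal{L}(s'))=q'$ and $0$ otherwise, and acceptance pairs $F^\phi=\{(L^\phi(i),K^\phi(i))\}_{i=1}^M$ with $(s,q)\in L^\phi(i)$ iff $q\in L(i)$,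 $(s,q)\in K^\phi(i)$ iff $q\in K(i)$. **FSCs and structures.** A finite state controller is $\mathcal{C}_*=(G_*,g_{0_*},\mu_* )$, $*\in\{d,a\}$, with $G_*$ finite, $g_{0_*}\in G_*$, and $\mu_*(g'_*,u_*|g_*,o_* )$ a probability distribution over $(g'_*,u_* )\in G_*\times U_*$ for each $(g_*,o_* )\in G_*\times\mathcal{O}_*$. Its structure is $\mathcal{I}_*:G_*\times\mathcal{O}_*\times G_*\times U_*\to\{0,1\}$ with $\mathcal{I}_*(g',u|g,o)=1\Leftrightarrow\mu_*(g',u|g,o)>0$. It is assumed that for every $(g,o)\in G_*\times\mathcal{O}_*$ there is $(g',u)$ with $\mathcal{I}_*(g',u|g,o)=1$. **Global Markov chain (GMC).** State space $S^\phi\times G_d\times G_a$, initial state $(s_0,q_0,g_{0_d},g_{0_a})$, transition probabilities $$\bar{\mathbb{T}}((s',q'),g'_d,g'_a|(s,q),g_d,g_a)=\sum_{o,o',u_d,u_a}O_d(o|s)O_a(o'|s)\mu_d(g'_d,u_d|g_d,o)\mu_a(g'_a,u_a|g_a,o')\mathbb{T}^\phi((s',q')|(s,q),u_d,u_a).$$ Its digraph (edges = positive-probability transitions) depends only on the structures $\mathcal{I}_d,\mathcal{I}_a$. Recurrence classes are the sink strongly connected components (SCCs). A recurrence class $R$, with set of $(s,q)$-components $R^S$, is $\phi$-feasible if there is $i$ with $K^\phi(i)\cap R^S\ne\emptyset$ and $L^\phi(i)\cap R^S=\emptyset$. **Algorithm GenerateCandidateFSCs.** Input: fixed finite sets $G_d,G_a$,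 the product $\mathcal{SG}^\phi$, and initial structures $\mathcal{I}_d^o,\mathcal{I}_a^o$ (identically $1$). Output: a set $\mathbb{I}$ of pairs of structures, initially empty. 1. Form the digraph $\mathcal{G}$ of the GMC under $\mathcal{I}_d^o,\mathcal{I}_a^o$ and its SCCs $C_1,\dots,C_N$. 2. For each SCC $C$ and each pair $(L^\phi(i),K^\phi(i))\in F^\phi$: - $Bad_i:=\{\mathfrak{s}'\notin C:\exists\,\mathfrak{s}\in C,\ \mathfrak{s}\to\mathfrak{s}'\}\cup(C\cap(L^\phi(i)\times G_d\times G_a))$; $Good_i:=C\cap(K^\phi(i)\times G_d\times G_a)$; set $\mathcal{I}_*\equiv1$ for $*\in\{d,a\}$. - While $\sum_{g'_*,u_*}\mathcal{I}_*(g'_*,u_*|g_*,o_* )>0$ for all $o_*,g_*$ and $Bad_i\neq\emptyset$: choose $\mathfrak{s}'=(s',q',g'_d,g'_a)\in Bad_i$ and $\mathfrak{s}''=(s'',q'',g''_d,g''_a)\in Good_i$. For each $\mathfrak{s}=(s,q,g_d,g_a)\in C\setminus Bad_i$ do the following. (a) For each $u_d\in U_d$: set $\mu_*(g'_*,u_*|g_*,o_* )=\mathcal{I}_*(g'_*,u_*|g_*,o_* )/\sum_{g'_*,u_*}\mathcal{I}_*(g'_*,u_*|g_*,o_* )$; if, under observations $o_d,o_a$, there is $u_a\in U_a$ with $O_d(o_d|s)O_a(o_a|s)\mu_d(g'_d,u_d|g_d,o_d)\mu_a(g'_a,u_a|g_a,o_a)\mathbb{T}^\phi((s',q')|(s,q),u_d,u_a)>0$,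 set $\mathcal{I}_d(g'_d,u_d|g_d,o_d)\leftarrow0$ for all $g'_d,g_d\in G_d$. (b) For each $u_a\in U_a$: recompute $\mu_*$ from $\mathcal{I}_*$ by the same normalization; if, under observations $o_d,o_a$, for all $u_d\in U_d$ one has $O_d(o_d|s)O_a(o_a|s)\mu_d(g''_d,u_d|g_d,o_d)\mu_a(g''_a,u_a|g_a,o_a)\mathbb{T}^\phi((s'',q'')|(s,q),u_d,u_a)>0$, set $\mathcal{I}_a(g''_a,u_a|g_a,o_a)\leftarrow0$. After treating all such $\mathfrak{s}$, set $Bad_i:=Bad_i\setminus\{\mathfrak{s}'\}$. - After the while loop, construct the digraph $\mathcal{G}_{new}$ of the GMC under the modified $\mathcal{I}_d,\mathcal{I}_a$ and its SCCs. If some $\mathfrak{s}\in Good_i$ is recurrent in $\mathcal{G}_{new}$, add the pair $(\mathcal{I}_d,\mathcal{I}_a)$ to $\mathbb{I}$.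
   Formalization: The formal theorem assumes L(i) and K(i) are disjoint for every Rabin pair (the claim fails otherwise, e.g. for a one-state chain with L=K), and it claims nothing for output pairs with an all-zero row, which no finite state controller has as structure. *)

theory Defs
  imports "HOL-Probability.Probability_Mass_Function" "Graph_Theory.Digraph_Component"
begin

section \<open>Partially observable stochastic games and their products\<close>

text \<open>All sets of the model that are required to be finite and non-empty are types of class
  \<open>finite\<close>; atomic propositions are the elements of an arbitrary type.\<close>

record ('s::finite, 'ud::finite, 'ua::finite, 'od::finite, 'oa::finite, 'ap) posg =
  init_state :: 's
  transition :: "'s \<Rightarrow> 'ud \<Rightarrow> 'ua \<Rightarrow> 's pmf"
  obs_d :: "'s \<Rightarrow> 'od pmf"
  obs_a :: "'s \<Rightarrow> 'oa pmf"
  labeling :: "'s \<Rightarrow> 'ap set"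

text \<open>A pair \<open>(L, K)\<close> in \<open>rabin_pairs\<close> asks for \<open>L\<close> to be visited finitely often and
  \<open>K\<close> infinitely often. The two sets may overlap; where disjointness is needed it is an explicit
  hypothesis.\<close>

record ('q::finite, 'ap) dra =
  dra_init :: 'q
  delta :: "'q \<Rightarrow> 'ap set \<Rightarrow> 'q"
  rabin_pairs :: "('q set \<times> 'q set) list"

fun prod_trans ::
  "('s::finite, 'ud::finite, 'ua::finite, 'od::finite, 'oa::finite, 'ap) posg \<Rightarrow> ('q::finite, 'ap) dra
    \<Rightarrow> 's \<times> 'q \<Rightarrow> 'ud \<Rightarrow> 'ua \<Rightarrow> 's \<times> 'q \<Rightarrow> real" where
  "prod_trans SG A (s, q) ud ua (s', q') =
     (if delta A q (labeling SG s') = q' then pmf (transition SG s ud ua) s' else 0)"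

definition prod_L :: "('q::finite, 'ap) dra \<Rightarrow> nat \<Rightarrow> ('s::finite \<times> 'q) set" where
  "prod_L A i = {(s, q). q \<in> fst (rabin_pairs A ! i)}"

definition prod_K :: "('q::finite, 'ap) dra \<Rightarrow> nat \<Rightarrow> ('s::finite \<times> 'q) set" where
  "prod_K A i = {(s, q). q \<in> snd (rabin_pairs A ! i)}"

section \<open>Finite state controllers and their structures\<close>

record ('g::finite, 'u::finite, 'o::finite) fsc =
  fsc_init :: 'g
  fsc_mu :: "'g \<Rightarrow> 'o \<Rightarrow> ('g \<times> 'u) pmf"

text \<open>The arguments of a policy or structure are in the order \<open>g' u g o\<close> of
  \<open>\<mu>(g', u | g, o)\<close>. A policy is an arbitrary real function, since the algorithm below also
  forms policies from structures with all-zero rows.\<close>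

type_synonym ('g, 'u, 'o) policy = "'g \<Rightarrow> 'u \<Rightarrow> 'g \<Rightarrow> 'o \<Rightarrow> real"
type_synonym ('g, 'u, 'o) fsc_structure = "'g \<Rightarrow> 'u \<Rightarrow> 'g \<Rightarrow> 'o \<Rightarrow> bool"

definition policy_of :: "('g::finite, 'u::finite, 'o::finite) fsc \<Rightarrow> ('g, 'u, 'o) policy" where
  "policy_of C g' u g ob = pmf (fsc_mu C g ob) (g', u)"

definition structure_of :: "('g::finite, 'u::finite, 'o::finite) fsc \<Rightarrow> ('g, 'u, 'o) fsc_structure" where
  "structure_of C g' u g ob \<longleftrightarrow> policy_of C g' u g ob > 0"

definition row_sum :: "('g::finite, 'u::finite, 'o::finite) fsc_structure \<Rightarrow> 'g \<Rightarrow> 'o \<Rightarrow> real" where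
  "row_sum I g ob = (\<Sum>g'\<in>UNIV. \<Sum>u\<in>UNIV. of_bool (I g' u g ob))"

text \<open>On an all-zero row this is zero, by \<open>x / 0 = 0\<close>.\<close>

definition normalized :: "('g::finite, 'u::finite, 'o::finite) fsc_structure \<Rightarrow> ('g, 'u, 'o) policy" where
  "normalized I g' u g ob = of_bool (I g' u g ob) / row_sum I g ob"

section \<open>The global Markov chain\<close>

type_synonym ('s, 'q, 'gd, 'ga) gstate = "('s \<times> 'q) \<times> 'gd \<times> 'ga"

fun branch_prob ::
  "('s::finite, 'ud::finite, 'ua::finite, 'od::finite, 'oa::finite, 'ap) posg \<Rightarrow> ('q::finite, 'ap) dra
    \<Rightarrow> ('gd::finite, 'ud, 'od) policy \<Rightarrow> ('ga::finite, 'ua, 'oa) policy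
    \<Rightarrow> 'od \<Rightarrow> 'oa \<Rightarrow> 'ud \<Rightarrow> 'ua
    \<Rightarrow> ('s, 'q, 'gd, 'ga) gstate \<Rightarrow> ('s, 'q, 'gd, 'ga) gstate \<Rightarrow> real" where
  "branch_prob SG A \<mu>d \<mu>a od oa ud ua ((s, q), gd, ga) ((s', q'), gd', ga') =
     pmf (obs_d SG s) od * pmf (obs_a SG s) oa * \<mu>d gd' ud gd od * \<mu>a ga' ua ga oa
       * prod_trans SG A (s, q) ud ua (s', q')"

definition gmc_prob ::
  "('s::finite, 'ud::finite, 'ua::finite, 'od::finite, 'oa::finite, 'ap) posg \<Rightarrow> ('q::finite, 'ap) dra
    \<Rightarrow> ('gd::finite, 'ud, 'od) policy \<Rightarrow> ('ga::finite, 'ua, 'oa) policy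
    \<Rightarrow> ('s, 'q, 'gd, 'ga) gstate \<Rightarrow> ('s, 'q, 'gd, 'ga) gstate \<Rightarrow> real" where
  "gmc_prob SG A \<mu>d \<mu>a x y =
     (\<Sum>od\<in>UNIV. \<Sum>oa\<in>UNIV. \<Sum>ud\<in>UNIV. \<Sum>ua\<in>UNIV. branch_prob SG A \<mu>d \<mu>a od oa ud ua x y)"

definition gmc_digraph ::
  "('s::finite, 'ud::finite, 'ua::finite, 'od::finite, 'oa::finite, 'ap) posg \<Rightarrow> ('q::finite, 'ap) dra
    \<Rightarrow> ('gd::finite, 'ud, 'od) policy \<Rightarrow> ('ga::finite, 'ua, 'oa) policy
    \<Rightarrow> ('s, 'q, 'gd, 'ga) gstate pair_pre_digraph" where
  "gmc_digraph SG A \<mu>d \<mu>a =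
     \<lparr>pverts = UNIV, parcs = {(x, y). gmc_prob SG A \<mu>d \<mu>a x y > 0}\<rparr>"

definition recurrence_classes :: "'v pair_pre_digraph \<Rightarrow> 'v set set" where
  "recurrence_classes D =
     {R \<in> pre_digraph.sccs_verts (with_proj D). \<forall>x\<in>R. \<forall>y. (x, y) \<in> parcs D \<longrightarrow> y \<in> R}"

definition feasible ::
  "('q::finite, 'ap) dra \<Rightarrow> ('s::finite, 'q, 'gd::finite, 'ga::finite) gstate set \<Rightarrow> bool" where
  "feasible A R \<longleftrightarrow> (\<exists>i<length (rabin_pairs A).
     prod_K A i \<inter> fst ` R \<noteq> {} \<and> prod_L A i \<inter> fst ` R = {})"

section \<open>Generating candidate structures\<close>

text \<open>The algorithm leaves several choices open (the order in which loops traverse a set, the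
  elements picked from \<open>Bad\<close> and \<open>Good\<close>), so it is modelled as a relation between the program
  states before and after execution.\<close>

fun run_list :: "('x \<Rightarrow> 'st \<Rightarrow> 'st \<Rightarrow> bool) \<Rightarrow> 'x list \<Rightarrow> 'st \<Rightarrow> 'st \<Rightarrow> bool" where
  "run_list step [] \<sigma> \<tau> \<longleftrightarrow> \<tau> = \<sigma>"
| "run_list step (x # xs) \<sigma> \<tau> \<longleftrightarrow> (\<exists>\<rho>. step x \<sigma> \<rho> \<and> run_list step xs \<rho> \<tau>)"

definition for_each :: "('x \<Rightarrow> 'st \<Rightarrow> 'st \<Rightarrow> bool) \<Rightarrow> 'x set \<Rightarrow> 'st \<Rightarrow> 'st \<Rightarrow> bool" where
  "for_each step X \<sigma> \<tau> \<longleftrightarrow> (\<exists>xs. distinct xs \<and> set xs = X \<and> run_list step xs \<sigma> \<tau>)"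

inductive run_while :: "('st \<Rightarrow> bool) \<Rightarrow> ('st \<Rightarrow> 'st \<Rightarrow> bool) \<Rightarrow> 'st \<Rightarrow> 'st \<Rightarrow> bool"
  for guard :: "'st \<Rightarrow> bool" and body :: "'st \<Rightarrow> 'st \<Rightarrow> bool" where
  stop: "\<not> guard \<sigma> \<Longrightarrow> run_while guard body \<sigma> \<sigma>"
| iterate: "guard \<sigma> \<Longrightarrow> body \<sigma> \<rho> \<Longrightarrow> run_while guard body \<rho> \<tau> \<Longrightarrow> run_while guard body \<sigma> \<tau>"

type_synonym ('ud, 'ua, 'od, 'oa, 'gd, 'ga) structures =
  "('gd, 'ud, 'od) fsc_structure \<times> ('ga, 'ua, 'oa) fsc_structure"

text \<open>Step (a), for the defender action \<open>ud\<close>: every entry with this action is removed, whatever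
  its \<open>g'\<close> and \<open>g\<close>, in the rows of each observation \<open>od\<close> under which some adversary observation
  and action allow a move from \<open>x\<close> to the bad state \<open>b\<close>.\<close>

fun prune_d ::
  "('s::finite, 'ud::finite, 'ua::finite, 'od::finite, 'oa::finite, 'ap) posg \<Rightarrow> ('q::finite, 'ap) dra
    \<Rightarrow> ('s, 'q, 'gd::finite, 'ga::finite) gstate \<Rightarrow> ('s, 'q, 'gd, 'ga) gstate \<Rightarrow> 'ud
    \<Rightarrow> ('ud, 'ua, 'od, 'oa, 'gd, 'ga) structures \<Rightarrow> ('ud, 'ua, 'od, 'oa, 'gd, 'ga) structures" where
  "prune_d SG A b x ud (Jd, Ja) =
     ((\<lambda>g' u g od. Jd g' u g od \<and>
         \<not> (u = ud \<and> (\<exists>oa ua. branch_prob SG A (normalized Jd) (normalized Ja) od oa ud ua x b > 0))),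
      Ja)"

text \<open>Step (b), for the adversary action \<open>ua\<close>: only the entries whose \<open>g'\<close> and \<open>g\<close> are the
  adversary components of the good state and of \<open>x\<close> are removed.\<close>

fun prune_a ::
  "('s::finite, 'ud::finite, 'ua::finite, 'od::finite, 'oa::finite, 'ap) posg \<Rightarrow> ('q::finite, 'ap) dra
    \<Rightarrow> ('s, 'q, 'gd::finite, 'ga::finite) gstate \<Rightarrow> ('s, 'q, 'gd, 'ga) gstate \<Rightarrow> 'ua
    \<Rightarrow> ('ud, 'ua, 'od, 'oa, 'gd, 'ga) structures \<Rightarrow> ('ud, 'ua, 'od, 'oa, 'gd, 'ga) structures" where
  "prune_a SG A good x ua (Jd, Ja) =
     (Jd,
      (\<lambda>g' u g oa. Ja g' u g oa \<and>
         \<not> (g' = snd (snd good) \<and> u = ua \<and> g = snd (snd x) \<and>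
            (\<exists>od. \<forall>ud. branch_prob SG A (normalized Jd) (normalized Ja) od oa ud ua x good > 0))))"

definition treat_state ::
  "('s::finite, 'ud::finite, 'ua::finite, 'od::finite, 'oa::finite, 'ap) posg \<Rightarrow> ('q::finite, 'ap) dra
    \<Rightarrow> ('s, 'q, 'gd::finite, 'ga::finite) gstate \<Rightarrow> ('s, 'q, 'gd, 'ga) gstate
    \<Rightarrow> ('s, 'q, 'gd, 'ga) gstate
    \<Rightarrow> ('ud, 'ua, 'od, 'oa, 'gd, 'ga) structures
    \<Rightarrow> ('ud, 'ua, 'od, 'oa, 'gd, 'ga) structures \<Rightarrow> bool" where
  "treat_state SG A b good x \<sigma> \<tau> \<longleftrightarrow>
     (\<exists>\<rho>. for_each (\<lambda>ud \<alpha> \<beta>. \<beta> = prune_d SG A b x ud \<alpha>) UNIV \<sigma> \<rho> \<and>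
          for_each (\<lambda>ua \<alpha> \<beta>. \<beta> = prune_a SG A good x ua \<alpha>) UNIV \<rho> \<tau>)"

definition initial_bad ::
  "('q::finite, 'ap) dra \<Rightarrow> ('s::finite, 'q, 'gd::finite, 'ga::finite) gstate pair_pre_digraph
    \<Rightarrow> ('s, 'q, 'gd, 'ga) gstate set \<Rightarrow> nat \<Rightarrow> ('s, 'q, 'gd, 'ga) gstate set" where
  "initial_bad A D C i = {y. y \<notin> C \<and> (\<exists>x\<in>C. (x, y) \<in> parcs D)} \<union> (C \<inter> (prod_L A i \<times> UNIV))"

definition good_states ::
  "('q::finite, 'ap) dra \<Rightarrow> ('s::finite, 'q, 'gd::finite, 'ga::finite) gstate set \<Rightarrow> nat
    \<Rightarrow> ('s, 'q, 'gd, 'ga) gstate set" where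
  "good_states A C i = C \<inter> (prod_K A i \<times> UNIV)"

fun loop_guard ::
  "'v set \<times> ('ud::finite, 'ua::finite, 'od::finite, 'oa::finite, 'gd::finite, 'ga::finite) structures
    \<Rightarrow> bool" where
  "loop_guard (Bad, Jd, Ja) \<longleftrightarrow>
     (\<forall>g ob. row_sum Jd g ob > 0) \<and> (\<forall>g ob. row_sum Ja g ob > 0) \<and> Bad \<noteq> {}"

text \<open>If there is no good state to choose, the choice is arbitrary instead of blocking the
  execution; nothing is added to the output in that case.\<close>

fun loop_body ::
  "('s::finite, 'ud::finite, 'ua::finite, 'od::finite, 'oa::finite, 'ap) posg \<Rightarrow> ('q::finite, 'ap) dra
    \<Rightarrow> ('s, 'q, 'gd::finite, 'ga::finite) gstate set \<Rightarrow> ('s, 'q, 'gd, 'ga) gstate set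
    \<Rightarrow> ('s, 'q, 'gd, 'ga) gstate set \<times> ('ud, 'ua, 'od, 'oa, 'gd, 'ga) structures
    \<Rightarrow> ('s, 'q, 'gd, 'ga) gstate set \<times> ('ud, 'ua, 'od, 'oa, 'gd, 'ga) structures \<Rightarrow> bool" where
  "loop_body SG A C Good (Bad, \<sigma>) (Bad', \<sigma>') \<longleftrightarrow>
     (\<exists>b\<in>Bad. \<exists>good. (Good \<noteq> {} \<longrightarrow> good \<in> Good) \<and>
        for_each (treat_state SG A b good) (C - Bad) \<sigma> \<sigma>' \<and> Bad' = Bad - {b})"

definition full_structure :: "('g, 'u, 'o) fsc_structure" where
  "full_structure g' u g ob = True"

definition process_pair ::
  "('s::finite, 'ud::finite, 'ua::finite, 'od::finite, 'oa::finite, 'ap) posg \<Rightarrow> ('q::finite, 'ap) dra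
    \<Rightarrow> ('s, 'q, 'gd::finite, 'ga::finite) gstate pair_pre_digraph
    \<Rightarrow> ('s, 'q, 'gd, 'ga) gstate set \<Rightarrow> nat
    \<Rightarrow> ('ud, 'ua, 'od, 'oa, 'gd, 'ga) structures set
    \<Rightarrow> ('ud, 'ua, 'od, 'oa, 'gd, 'ga) structures set \<Rightarrow> bool" where
  "process_pair SG A D C i II II' \<longleftrightarrow>
     (\<exists>Bad Jd Ja.
        run_while loop_guard (loop_body SG A C (good_states A C i))
          (initial_bad A D C i, full_structure, full_structure) (Bad, Jd, Ja) \<and>
        II' = (if \<exists>R \<in> recurrence_classes (gmc_digraph SG A (normalized Jd) (normalized Ja)).
                    good_states A C i \<inter> R \<noteq> {}
               then insert (Jd, Ja) II else II))"

text \<open>\<open>generate_candidate_fscs SG A II\<close>: some execution of the algorithm outputs \<open>II\<close>. The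
  controller state sets are the types \<open>'gd\<close> and \<open>'ga\<close>.\<close>

definition generate_candidate_fscs ::
  "('s::finite, 'ud::finite, 'ua::finite, 'od::finite, 'oa::finite, 'ap) posg \<Rightarrow> ('q::finite, 'ap) dra
    \<Rightarrow> ('ud, 'ua, 'od, 'oa, 'gd::finite, 'ga::finite) structures set \<Rightarrow> bool" where
  "generate_candidate_fscs SG A II \<longleftrightarrow>
     (let D = (gmc_digraph SG A (normalized full_structure) (normalized full_structure)
                 :: ('s, 'q, 'gd, 'ga) gstate pair_pre_digraph)
      in for_each (\<lambda>C. for_each (process_pair SG A D C) {..<length (rabin_pairs A)})
           (pre_digraph.sccs_verts (with_proj D)) {} II)"

end

(* If a candidate (Jd, Ja) is the pair of structures of two controllers, its rows are non-empty, so
   the while loop that produced it stopped with Bad empty: every initially bad state b has been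
   picked, and at that moment every state of N = C - Bad (for the initial Bad) was treated, which
   removes all its moves to b. The structures only shrink and positivity of a transition is monotone
   in them, so these moves never come back. An edge leaving N would end in C - N or outside C, that
   is, in an initially bad state; hence N is closed. By disjointness a good state lies in N, so the
   recurrence class through it lies in N and avoids L. *)

theory Submission
  imports Defs
begin

section \<open>Invariants of the nondeterministic loops\<close>

lemma run_list_invariant:
  assumes "run_list step xs \<sigma> \<tau>" "P \<sigma>"
    and "\<And>x \<alpha> \<beta>. x \<in> set xs \<Longrightarrow> step x \<alpha> \<beta> \<Longrightarrow> P \<alpha> \<Longrightarrow> P \<beta>"
  shows "P \<tau>"
  using assms
proof (induction xs arbitrary: \<sigma>)
  case Nil
  then show ?case by simp
next
  case (Cons x xs)
  obtain \<rho> where "step x \<sigma> \<rho>" and rest: "run_list step xs \<rho> \<tau>"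
    using Cons.prems(1) by auto
  then have "P \<rho>"
    using Cons.prems(2,3) by (meson list.set_intros(1))
  with rest show ?case
    by (rule Cons.IH) (rule Cons.prems(3)[OF list.set_intros(2)])
qed

lemma for_each_invariant:
  assumes "for_each step X \<sigma> \<tau>" "P \<sigma>"
    and "\<And>x \<alpha> \<beta>. x \<in> X \<Longrightarrow> step x \<alpha> \<beta> \<Longrightarrow> P \<alpha> \<Longrightarrow> P \<beta>"
  shows "P \<tau>"
proof -
  obtain xs where xs: "set xs = X" "run_list step xs \<sigma> \<tau>"
    using assms(1) unfolding for_each_def by blast
  from xs(2) assms(2) show ?thesis
    by (rule run_list_invariant[where P = P]) (rule assms(3)[folded xs(1)])
qed

lemma run_list_append:
  "run_list step (xs @ ys) \<sigma> \<tau> \<longleftrightarrow> (\<exists>\<rho>. run_list step xs \<sigma> \<rho> \<and> run_list step ys \<rho> \<tau>)"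
  by (induction xs arbitrary: \<sigma>) auto

text \<open>The traversal order is unknown, so it is split at an occurrence of \<open>x\<close>:
  that step yields \<open>P\<close> from any state, and the steps after it preserve
  \<open>P\<close>.\<close>

lemma for_each_establishes:
  assumes "for_each step X \<sigma> \<tau>" "x \<in> X"
    and establish: "\<And>\<alpha> \<beta>. step x \<alpha> \<beta> \<Longrightarrow> P \<beta>"
    and preserve: "\<And>y \<alpha> \<beta>. y \<in> X \<Longrightarrow> step y \<alpha> \<beta> \<Longrightarrow> P \<alpha> \<Longrightarrow> P \<beta>"
  shows "P \<tau>"
proof -
  obtain xs where xs: "set xs = X" "run_list step xs \<sigma> \<tau>"
    using assms(1) unfolding for_each_def by blast
  then obtain ys zs where split: "xs = ys @ x # zs"
    using \<open>x \<in> X\<close> split_list by metis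
  with xs obtain \<alpha> \<beta> where step: "step x \<alpha> \<beta>" and rest: "run_list step zs \<beta> \<tau>"
    by (auto simp: run_list_append)
  show ?thesis
    using rest establish[OF step]
  proof (rule run_list_invariant[where P = P])
    fix y \<alpha> \<beta> assume "y \<in> set zs" and y: "step y \<alpha> \<beta>" "P \<alpha>"
    then have "y \<in> X" using xs(1) split by auto
    then show "P \<beta>" using y by (rule preserve)
  qed
qed

lemma run_while_invariant:
  assumes "run_while guard body \<sigma> \<tau>" "P \<sigma>"
    and "\<And>\<alpha> \<beta>. guard \<alpha> \<Longrightarrow> body \<alpha> \<beta> \<Longrightarrow> P \<alpha> \<Longrightarrow> P \<beta>"
  shows "P \<tau> \<and> \<not> guard \<tau>"
  using assms by (induction rule: run_while.induct) auto

section \<open>Supports of policies and positivity of transitions\<close>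

lemma row_sum_pos_iff: "row_sum I g ob > 0 \<longleftrightarrow> (\<exists>g' u. I g' u g ob)"
proof
  assume "row_sum I g ob > 0"
  then show "\<exists>g' u. I g' u g ob"
    by (rule contrapos_pp) (simp add: row_sum_def)
next
  assume "\<exists>g' u. I g' u g ob"
  then obtain g' u where "I g' u g ob" by blast
  then have "0 < (\<Sum>u\<in>UNIV. of_bool (I g' u g ob) :: real)"
    by (intro sum_pos2[where i = u]) auto
  then show "row_sum I g ob > 0"
    unfolding row_sum_def by (intro sum_pos2[where i = g']) (auto intro: sum_nonneg)
qed

lemma normalized_nonneg: "normalized I g' u g ob \<ge> 0"
  unfolding normalized_def row_sum_def by (intro divide_nonneg_nonneg sum_nonneg) auto

text \<open>A true entry makes its row sum positive. An all-zero row is no exception: all its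
  entries are false and \<open>0 / 0 = 0\<close>.\<close>

lemma normalized_pos_iff: "normalized I g' u g ob > 0 \<longleftrightarrow> I g' u g ob"
  using row_sum_pos_iff[of I g ob] by (auto simp: normalized_def)

lemma policy_of_nonneg: "policy_of C g' u g ob \<ge> 0"
  by (simp add: policy_of_def)

text \<open>A probability distribution has non-empty support. For structures of controllers this
  rules out that the loop stopped because of an all-zero row.\<close>

lemma structure_of_row: "\<exists>g' u. structure_of C g' u g ob"
proof -
  obtain z where "z \<in> set_pmf (fsc_mu C g ob)"
    using set_pmf_not_empty by fast
  then show ?thesis
    unfolding structure_of_def policy_of_def by (metis pmf_positive surj_pair)
qed

lemma prod_trans_nonneg: "prod_trans SG A x ud ua y \<ge> 0"
  by (cases x; cases y) simp

lemma branch_prob_nonneg: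
  assumes "\<And>g' u g ob. \<mu>d g' u g ob \<ge> 0" "\<And>g' u g ob. \<mu>a g' u g ob \<ge> 0"
  shows "branch_prob SG A \<mu>d \<mu>a od oa ud ua x y \<ge> 0"
  by (cases "(SG, A, \<mu>d, \<mu>a, od, oa, ud, ua, x, y)" rule: branch_prob.cases)
    (auto intro!: mult_nonneg_nonneg assms prod_trans_nonneg simp del: prod_trans.simps)

lemma branch_prob_pos_iff:
  assumes "\<And>g' u g ob. \<mu>d g' u g ob \<ge> 0" "\<And>g' u g ob. \<mu>a g' u g ob \<ge> 0"
  shows "branch_prob SG A \<mu>d \<mu>a od oa ud ua ((s, q), gd, ga) ((s', q'), gd', ga') > 0 \<longleftrightarrow>
    pmf (obs_d SG s) od > 0 \<and> pmf (obs_a SG s) oa > 0 \<and> \<mu>d gd' ud gd od > 0 \<and>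
    \<mu>a ga' ua ga oa > 0 \<and> prod_trans SG A (s, q) ud ua (s', q') > 0"
proof -
  have pos_mult: "a * b > 0 \<longleftrightarrow> a > 0 \<and> b > 0" if "a \<ge> 0" "b \<ge> 0" for a b :: real
    using that by (auto simp: zero_less_mult_iff)
  show ?thesis
    by (simp add: pos_mult assms prod_trans_nonneg del: prod_trans.simps)
qed

text \<open>Only positivity is compared: deleting entries can enlarge the remaining normalized
  values, so the probabilities themselves are not monotone in the structures. A product of
  nonnegative factors is positive iff every factor is.\<close>

lemma branch_prob_pos_mono:
  assumes "branch_prob SG A \<mu>d \<mu>a od oa ud ua x y > 0"
    and "\<And>g' u g ob. \<mu>d g' u g ob \<ge> 0" "\<And>g' u g ob. \<mu>a g' u g ob \<ge> 0"
    and "\<And>g' u g ob. \<nu>d g' u g ob \<ge> 0" "\<And>g' u g ob. \<nu>a g' u g ob \<ge> 0"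
    and "\<And>g' u g ob. \<mu>d g' u g ob > 0 \<Longrightarrow> \<nu>d g' u g ob > 0"
    and "\<And>g' u g ob. \<mu>a g' u g ob > 0 \<Longrightarrow> \<nu>a g' u g ob > 0"
  shows "branch_prob SG A \<nu>d \<nu>a od oa ud ua x y > 0"
proof -
  obtain s q gd ga s' q' gd' ga' where "x = ((s, q), gd, ga)" "y = ((s', q'), gd', ga')"
    by (metis surj_pair)
  then show ?thesis
    using assms(1,6,7) by (simp only: branch_prob_pos_iff[OF assms(2,3)] branch_prob_pos_iff[OF assms(4,5)])
qed

lemma sum_UNIV_pos_iff:
  fixes f :: "'i::finite \<Rightarrow> real"
  assumes "\<And>i. f i \<ge> 0"
  shows "sum f UNIV > 0 \<longleftrightarrow> (\<exists>i. f i > 0)"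
  using assms sum_nonneg[of UNIV f] sum_nonneg_eq_0_iff[of UNIV f]
  by (auto simp: less_le fun_eq_iff)

lemma gmc_prob_pos_iff:
  assumes "\<And>g' u g ob. \<mu>d g' u g ob \<ge> 0" "\<And>g' u g ob. \<mu>a g' u g ob \<ge> 0"
  shows "gmc_prob SG A \<mu>d \<mu>a x y > 0 \<longleftrightarrow>
    (\<exists>od oa ud ua. branch_prob SG A \<mu>d \<mu>a od oa ud ua x y > 0)"
  unfolding gmc_prob_def by (simp add: sum_UNIV_pos_iff sum_nonneg branch_prob_nonneg assms)

lemma normalized_structure_of_pos_iff:
  "normalized (structure_of C) g' u g ob > 0 \<longleftrightarrow> policy_of C g' u g ob > 0"
  by (simp only: normalized_pos_iff structure_of_def)

text \<open>Positivity of a branch depends on the supports alone. Hence the recurrence test that the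
  algorithm makes with normalized policies carries over to all controllers with these
  structures.\<close>

lemma gmc_digraph_policy_of:
  "gmc_digraph SG A (policy_of Cd) (policy_of Ca) =
    gmc_digraph SG A (normalized (structure_of Cd)) (normalized (structure_of Ca))"
proof -
  note nonneg = policy_of_nonneg normalized_nonneg
  have "branch_prob SG A (policy_of Cd) (policy_of Ca) od oa ud ua x y > 0 \<longleftrightarrow>
      branch_prob SG A (normalized (structure_of Cd)) (normalized (structure_of Ca)) od oa ud ua x y > 0"
    for od oa ud ua x y
  proof -
    obtain s q gd ga s' q' gd' ga' where xy: "x = ((s, q), gd, ga)" "y = ((s', q'), gd', ga')"
      by (metis surj_pair)
    show ?thesis
      unfolding xy by (simp only: branch_prob_pos_iff nonneg normalized_structure_of_pos_iff)
  qed
  then show ?thesis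
    unfolding gmc_digraph_def by (simp only: gmc_prob_pos_iff nonneg)
qed

section \<open>Moves blocked by pruning\<close>

text \<open>\<open>ud\<close> is a parameter because each call of \<open>prune_d\<close> cuts the
  moves of a single defender action.\<close>

definition blocked where
  "blocked SG A x b ud \<sigma> \<longleftrightarrow>
    (\<forall>od oa ua. \<not> branch_prob SG A (normalized (fst \<sigma>)) (normalized (snd \<sigma>)) od oa ud ua x b > 0)"

text \<open>A move possible with fewer entries is possible with more, so later pruning cannot reopen
  a blocked one. The order on structures is entrywise implication.\<close>

lemma blocked_mono:
  assumes "blocked SG A x b ud \<sigma>" "fst \<tau> \<le> fst \<sigma>" "snd \<tau> \<le> snd \<sigma>"
  shows "blocked SG A x b ud \<tau>"
  unfolding blocked_def
proof (intro allI notI)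
  fix od oa ua
  assume "branch_prob SG A (normalized (fst \<tau>)) (normalized (snd \<tau>)) od oa ud ua x b > 0"
  then have "branch_prob SG A (normalized (fst \<sigma>)) (normalized (snd \<sigma>)) od oa ud ua x b > 0"
    by (rule branch_prob_pos_mono)
      (use assms(2,3) in \<open>auto simp: normalized_nonneg normalized_pos_iff le_fun_def\<close>)
  with assms(1) show False by (auto simp: blocked_def)
qed

lemma prune_d_le: "fst (prune_d SG A b x ud \<sigma>) \<le> fst \<sigma>" "snd (prune_d SG A b x ud \<sigma>) \<le> snd \<sigma>"
  by (cases \<sigma>, force simp: le_fun_def)+

lemma prune_a_le: "fst (prune_a SG A good x ua \<sigma>) \<le> fst \<sigma>" "snd (prune_a SG A good x ua \<sigma>) \<le> snd \<sigma>"
  by (cases \<sigma>, force simp: le_fun_def)+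

text \<open>The pruning test uses the policies before the deletion. A move left afterwards was
  possible before, so its observation \<open>od\<close> passed the test, which cleared every entry
  of \<open>ud\<close> in the rows of \<open>od\<close>, including the one that the move
  needs.\<close>

lemma blocked_prune_d_same: "blocked SG A x b ud (prune_d SG A b x ud \<sigma>)"
  unfolding blocked_def
proof (intro allI notI)
  fix od oa ua
  let ?\<tau> = "prune_d SG A b x ud \<sigma>"
  assume pos: "branch_prob SG A (normalized (fst ?\<tau>)) (normalized (snd ?\<tau>)) od oa ud ua x b > 0"
  then have "branch_prob SG A (normalized (fst \<sigma>)) (normalized (snd \<sigma>)) od oa ud ua x b > 0"
    by (rule branch_prob_pos_mono)
      (use prune_d_le[of SG A b x ud \<sigma>] in \<open>auto simp: normalized_nonneg normalized_pos_iff le_fun_def\<close>)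
  then have removed: "\<not> fst ?\<tau> g' ud g od" for g' g
    by (cases \<sigma>) auto
  obtain s q gd ga s' q' gd' ga' where "x = ((s, q), gd, ga)" "b = ((s', q'), gd', ga')"
    by (metis surj_pair)
  with pos have "fst ?\<tau> gd' ud gd od"
    by (simp only: branch_prob_pos_iff normalized_nonneg normalized_pos_iff)
  with removed show False by blast
qed

lemma treat_state_invariant:
  assumes "treat_state SG A b good x \<sigma> \<tau>" "P \<sigma>"
    and "\<And>\<alpha> \<beta>. fst \<beta> \<le> fst \<alpha> \<Longrightarrow> snd \<beta> \<le> snd \<alpha> \<Longrightarrow> P \<alpha> \<Longrightarrow> P \<beta>"
  shows "P \<tau>"
proof -
  obtain \<rho> where d: "for_each (\<lambda>ud \<alpha> \<beta>. \<beta> = prune_d SG A b x ud \<alpha>) UNIV \<sigma> \<rho>"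
    and a: "for_each (\<lambda>ua \<alpha> \<beta>. \<beta> = prune_a SG A good x ua \<alpha>) UNIV \<rho> \<tau>"
    using assms(1) unfolding treat_state_def by blast
  have "P \<rho>" using d assms(2)
    by (rule for_each_invariant[where P = P]) (simp add: assms(3)[OF prune_d_le])
  with a show ?thesis
    by (rule for_each_invariant[where P = P]) (simp add: assms(3)[OF prune_a_le])
qed

text \<open>The call of \<open>prune_d\<close> for \<open>ud\<close> blocks; the other calls, and
  all of step (b), only shrink the structures.\<close>

lemma treat_state_blocked:
  assumes "treat_state SG A b good x \<sigma> \<tau>"
  shows "blocked SG A x b ud \<tau>"
proof -
  obtain \<rho> where d: "for_each (\<lambda>ud \<alpha> \<beta>. \<beta> = prune_d SG A b x ud \<alpha>) UNIV \<sigma> \<rho>"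
    and a: "for_each (\<lambda>ua \<alpha> \<beta>. \<beta> = prune_a SG A good x ua \<alpha>) UNIV \<rho> \<tau>"
    using assms unfolding treat_state_def by blast
  have "blocked SG A x b ud \<rho>"
    by (rule for_each_establishes[OF d UNIV_I[of ud], where P = "blocked SG A x b ud"])
      (simp_all add: blocked_prune_d_same blocked_mono[OF _ prune_d_le])
  with a show ?thesis
    by (rule for_each_invariant[where P = "blocked SG A x b ud"])
      (simp add: blocked_mono[OF _ prune_a_le])
qed

text \<open>The set of treated states varies from round to round, but a state outside the initial
  bad set is outside every later one. So \<open>x\<close> is treated in every round, which blocks
  its moves to the bad state picked there.\<close>

lemma loop_blocks:
  assumes run: "run_while loop_guard (loop_body SG A C Good) (B, \<sigma>) (Bad, \<tau>)"
    and "x \<in> C - B" "b \<in> B - Bad"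
  shows "blocked SG A x b ud \<tau>"
proof -
  \<comment> \<open>Only picked states leave the bad set, so \<open>B - Bad'\<close> consists of the
    states picked so far.\<close>
  define P where "P = (\<lambda>(Bad', \<rho>). Bad' \<subseteq> B \<and> (\<forall>b\<in>B - Bad'. blocked SG A x b ud \<rho>))"
  have "P \<beta>" if body: "loop_body SG A C Good \<alpha> \<beta>" and "P \<alpha>" for \<alpha> \<beta>
  proof -
    obtain B1 \<sigma>1 B2 \<sigma>2 where ab: "\<alpha> = (B1, \<sigma>1)" "\<beta> = (B2, \<sigma>2)"
      by (metis surj_pair)
    have "B1 \<subseteq> B" and blocked: "\<And>b. b \<in> B - B1 \<Longrightarrow> blocked SG A x b ud \<sigma>1"
      using \<open>P \<alpha>\<close> by (auto simp: P_def ab)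
    obtain b0 good where "b0 \<in> B1" and treat: "for_each (treat_state SG A b0 good) (C - B1) \<sigma>1 \<sigma>2"
      and "B2 = B1 - {b0}"
      using body unfolding ab loop_body.simps by blast
    \<comment> \<open>The bad state \<open>b\<close> is arbitrary here: this serves both the newly
      picked \<open>b0\<close> and the states picked in earlier rounds.\<close>
    have keep: "blocked SG A x b ud \<gamma>'"
      if "treat_state SG A b0 good y \<gamma> \<gamma>'" "blocked SG A x b ud \<gamma>" for b y \<gamma> \<gamma>'
      using that
      by (rule treat_state_invariant[where P = "blocked SG A x b ud"]) (rule blocked_mono)
    have "x \<in> C - B1" using \<open>x \<in> C - B\<close> \<open>B1 \<subseteq> B\<close> by blast
    with treat have "blocked SG A x b0 ud \<sigma>2"
      by (rule for_each_establishes[where P = "blocked SG A x b0 ud"])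
        (fact treat_state_blocked, rule keep)
    moreover have "blocked SG A x b ud \<sigma>2" if "b \<in> B - B1" for b
      using treat blocked[OF that]
      by (rule for_each_invariant[where P = "blocked SG A x b ud"]) (rule keep)
    ultimately show ?thesis
      using \<open>B1 \<subseteq> B\<close> \<open>B2 = B1 - {b0}\<close> by (auto simp: P_def ab)
  qed
  moreover have "P (B, \<sigma>)" by (simp add: P_def)
  ultimately have "P (Bad, \<tau>)"
    using run_while_invariant[OF run, of P] by blast
  with \<open>b \<in> B - Bad\<close> show ?thesis by (simp add: P_def)
qed

section \<open>Closed sets and feasible recurrence classes\<close>

text \<open>A recurrence class is strongly connected, so all of it is reachable from
  \<open>r\<close>, and a path that starts in a closed set stays there.\<close>

lemma recurrence_class_subset_closed:
  assumes "R \<in> recurrence_classes D" "r \<in> R" "r \<in> N"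
    and closed: "\<And>x y. x \<in> N \<Longrightarrow> (x, y) \<in> parcs D \<Longrightarrow> y \<in> N"
  shows "R \<subseteq> N"
proof
  fix v assume "v \<in> R"
  then have "r \<rightarrow>\<^sup>*\<^bsub>with_proj D\<^esub> v"
    using assms(1,2) unfolding recurrence_classes_def pre_digraph.sccs_verts_def by blast
  then have "(r, v) \<in> rtrancl_on (pverts D) (parcs D)"
    by (simp add: reachable_def)
  then show "v \<in> N"
    by (induction rule: rtrancl_on_induct) (use \<open>r \<in> N\<close> closed in auto)
qed

text \<open>The assumption \<open>rows\<close> leaves an empty bad set as the only possible reason
  for the exit from the loop.\<close>

lemma candidate_feasible:
  fixes SG :: "('s::finite, 'ud::finite, 'ua::finite, 'od::finite, 'oa::finite, 'ap) posg"
    and A :: "('q::finite, 'ap) dra"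
    and C :: "('s, 'q, 'gd::finite, 'ga::finite) gstate set"
    and Jd :: "('gd, 'ud, 'od) fsc_structure" and Ja :: "('ga, 'ua, 'oa) fsc_structure"
  defines "D \<equiv> gmc_digraph SG A (normalized full_structure) (normalized full_structure)"
  assumes disjoint: "\<forall>(L, K) \<in> set (rabin_pairs A). L \<inter> K = {}"
    and i: "i < length (rabin_pairs A)"
    and run: "run_while loop_guard (loop_body SG A C (good_states A C i))
        (initial_bad A D C i, full_structure, full_structure) (Bad, Jd, Ja)"
    and rows: "\<And>g ob. \<exists>g' u. Jd g' u g ob" "\<And>g ob. \<exists>g' u. Ja g' u g ob"
    and R: "R \<in> recurrence_classes (gmc_digraph SG A (normalized Jd) (normalized Ja))"
    and good: "good_states A C i \<inter> R \<noteq> {}"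
  shows "feasible A R"
proof -
  define N where "N = C - initial_bad A D C i"
  have "\<not> loop_guard (Bad, Jd, Ja)"
    using run_while_invariant[OF run, of "\<lambda>_. True"] by simp
  then have "Bad = {}"
    using rows by (simp add: row_sum_pos_iff)
  obtain r where r: "r \<in> good_states A C i" "r \<in> R"
    using good by blast
  \<comment> \<open>As \<open>r\<close> is in \<open>C\<close>, only the \<open>prod_L\<close> part
    of \<open>initial_bad\<close> could contain it; disjointness excludes that.\<close>
  have "fst (rabin_pairs A ! i) \<inter> snd (rabin_pairs A ! i) = {}"
    using disjoint nth_mem[OF i] by (auto simp: case_prod_beta)
  then have "r \<in> N"
    using r by (auto simp: N_def initial_bad_def good_states_def prod_L_def prod_K_def)
  have "y \<in> N"
    if "x \<in> N" and edge: "(x, y) \<in> parcs (gmc_digraph SG A (normalized Jd) (normalized Ja))" for x y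
  proof (rule ccontr)
    assume "y \<notin> N"
    obtain od oa ud ua where
      pos: "branch_prob SG A (normalized Jd) (normalized Ja) od oa ud ua x y > 0"
      using edge by (auto simp: gmc_digraph_def gmc_prob_pos_iff normalized_nonneg)
    \<comment> \<open>The initial bad set was computed from the edges of the unpruned chain, so the
      edge is first lifted to \<open>D\<close>.\<close>
    then have "branch_prob SG A (normalized full_structure) (normalized full_structure) od oa ud ua x y > 0"
      by (rule branch_prob_pos_mono) (auto simp: normalized_nonneg normalized_pos_iff full_structure_def)
    then have "(x, y) \<in> parcs D"
      by (auto simp: D_def gmc_digraph_def gmc_prob_pos_iff normalized_nonneg)
    \<comment> \<open>Either \<open>y\<close> is outside \<open>C\<close> and a successor of
      \<open>x\<close> in \<open>D\<close>, or it is in \<open>C\<close> but not in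
      \<open>N\<close>; it is initially bad in both cases.\<close>
    with \<open>x \<in> N\<close> \<open>y \<notin> N\<close> have "y \<in> initial_bad A D C i - Bad"
      by (auto simp: N_def initial_bad_def \<open>Bad = {}\<close>)
    then have "blocked SG A x y ud (Jd, Ja)"
      using loop_blocks[OF run] \<open>x \<in> N\<close> N_def by blast
    with pos show False by (auto simp: blocked_def)
  qed
  with R r(2) \<open>r \<in> N\<close> have "R \<subseteq> N"
    by (rule recurrence_class_subset_closed)
  then have "prod_L A i \<inter> fst ` R = {}"
    by (force simp: N_def initial_bad_def)
  moreover have "fst r \<in> prod_K A i \<inter> fst ` R"
    using r by (auto simp: good_states_def)
  ultimately show ?thesis
    using i unfolding feasible_def by blast
qed

theorem propositionV3:
  fixes SG :: "('s::finite, 'ud::finite, 'ua::finite, 'od::finite, 'oa::finite, 'ap) posg"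
    and A :: "('q::finite, 'ap) dra"
    and II :: "('ud, 'ua, 'od, 'oa, 'gd::finite, 'ga::finite) structures set"
  assumes disjoint: "\<forall>(L, K) \<in> set (rabin_pairs A). L \<inter> K = {}"
    and generated: "generate_candidate_fscs SG A II"
  shows "\<forall>(Jd, Ja) \<in> II. \<forall>Cd Ca. structure_of Cd = Jd \<and> structure_of Ca = Ja \<longrightarrow>
    (\<exists>R \<in> recurrence_classes (gmc_digraph SG A (policy_of Cd) (policy_of Ca)). feasible A R)"
proof -
  define D :: "('s, 'q, 'gd, 'ga) gstate pair_pre_digraph" where
    "D = gmc_digraph SG A (normalized full_structure) (normalized full_structure)"
  \<comment> \<open>The invariant of the output set in both outer loops. A pair with an all-zero row
    satisfies it vacuously, since no controllers have these structures.\<close>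
  define correct where "correct = (\<lambda>II :: ('ud, 'ua, 'od, 'oa, 'gd, 'ga) structures set.
    \<forall>(Jd, Ja) \<in> II. \<forall>Cd Ca. structure_of Cd = Jd \<and> structure_of Ca = Ja \<longrightarrow>
      (\<exists>R \<in> recurrence_classes (gmc_digraph SG A (policy_of Cd) (policy_of Ca)). feasible A R))"
  have step: "correct II2"
    if process: "process_pair SG A D C i II1 II2" and "i < length (rabin_pairs A)" "correct II1"
    for C i II1 II2
  proof -
    obtain Bad Jd Ja where run: "run_while loop_guard (loop_body SG A C (good_states A C i))
          (initial_bad A D C i, full_structure, full_structure) (Bad, Jd, Ja)"
      and II2: "II2 = (if \<exists>R \<in> recurrence_classes (gmc_digraph SG A (normalized Jd) (normalized Ja)).
                    good_states A C i \<inter> R \<noteq> {} then insert (Jd, Ja) II1 else II1)"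
      using process unfolding process_pair_def by blast
    have new: "\<exists>R \<in> recurrence_classes (gmc_digraph SG A (policy_of Cd) (policy_of Ca)). feasible A R"
      if R: "R \<in> recurrence_classes (gmc_digraph SG A (normalized Jd) (normalized Ja))"
        "good_states A C i \<inter> R \<noteq> {}"
        and S: "structure_of Cd = Jd" "structure_of Ca = Ja" for R Cd Ca
    proof -
      \<comment> \<open>The controllers \<open>Cd\<close> and \<open>Ca\<close> supply the non-empty
        rows.\<close>
      have "feasible A R"
        by (rule candidate_feasible[OF disjoint \<open>i < _\<close> run[unfolded D_def] _ _ R])
          (use structure_of_row S in metis)+
      with R(1) S show ?thesis by (auto simp: gmc_digraph_policy_of)
    qed
    show ?thesis
    proof (cases "\<exists>R \<in> recurrence_classes (gmc_digraph SG A (normalized Jd) (normalized Ja)).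
        good_states A C i \<inter> R \<noteq> {}")
      case True
      then have "correct {(Jd, Ja)}"
        using new unfolding correct_def by blast
      with True II2 \<open>correct II1\<close> show ?thesis
        by (simp add: correct_def)
    next
      case False
      with II2 \<open>correct II1\<close> show ?thesis by simp
    qed
  qed
  have "for_each (\<lambda>C. for_each (process_pair SG A D C) {..<length (rabin_pairs A)})
      (pre_digraph.sccs_verts (with_proj D)) {} II"
    using generated by (simp add: generate_candidate_fscs_def Let_def D_def)
  then have "correct II"
  proof (rule for_each_invariant[where P = correct])
    show "correct {}" by (simp add: correct_def)
  next
    fix C II1 II2
    assume "for_each (process_pair SG A D C) {..<length (rabin_pairs A)} II1 II2" "correct II1"
    then show "correct II2"
      by (rule for_each_invariant[where P = correct]) (simp add: step)
  qed
  then show ?thesis by (simp only: correct_def)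
qed

end
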